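(* Let $m\ge1$ and $0\le\lambda\le m$. The cardinalities of the top sets $\mathcal T(\lambda)$ are as follows. (a) For $\overline{aTL_m}(\beta)$, $\overline{pTL_m}(\beta)$ or their reduced versions (with $\lambda\equiv m\bmod 2$): $\displaystyle\binom{m}{(m-\lambda)/2}$. (b) For $\overline{aMo_m}(\beta)$, $\overline{pMo_m}(\beta)$ or their reduced versions: $$\sum_{j=0}^{\lfloor(m-\lambda)/2\rfloor}\frac{m!}{j!\,(m-\lambda-2j)!\,(\lambda+j)!}=\sum_{j=0}^{\lfloor(m-\lambda)/2\rfloor}\binom mj\binom{m-j}{m-\lambda-2j}=[t^{m-\lambda}](1+t+t^2)^m .$$ (c) For $aPRo_m(\beta)$ or $pPRo_m(\beta)$: $\displaystyle\binom m\lambda$. (d) For $aRo_m(\beta)$, $pRo_m(\beta)$ or their reduced versions: $\displaystyle\binom m\lambda$.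
   Context: $[t^j]$ means "coefficient of $t^j$". These algebras (affine/periodic Temperley--Lieb $TL$, Motzkin $Mo$, planar rook $PRo$, rook $Ro$) have bases of diagrams on an infinite horizontal strip with top and bottom vertices at the integers, invariant under translation by $m$. The top set $\mathcal T(\lambda)$ is the set of top halves of such diagrams with exactly $\lambda$ through lines (modulo translation by $m$) and no non-contractible loops, where the endpoints at the bottom of the through lines (and their winding or permutation) are forgotten. The top set depends only on the diagram type and is the same for the affine, periodic and reduced versions. Explicitly, an element of $\mathcal T(\lambda)$ is a partition of $\mathbb Z$ into blocks of size at most $2$, invariant under translation by $m$, together with a translation-invariant set of marked singleton blocks forming exactly $\lambda$ orbits under translation by $m$ (the through lines), such that: - type $TL$: every unmarked block has size $2$, and the configuration is planar, i.e. drawing size-$2$ blocks as arcs below the line and marked points as vertical rays going down, there are no crossings; - type $Mo$: unmarked blocks have size $1$ (isolated) or $2$, and the configuration is planar in the same sense; - types $PRo$ and $Ro$: all blocks are singletons. *)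

theory Defs
  imports Complex_Main "HOL-Library.Disjoint_Sets" "HOL-Computational_Algebra.Polynomial"
begin

datatype diagram_type = TL | Mo | PRo | Ro

definition translate :: "int \<Rightarrow> int set \<Rightarrow> int set" where
  "translate k B = (\<lambda>x. x + k) ` B"

definition translation_invariant :: "nat \<Rightarrow> int set set \<Rightarrow> bool" where
  "translation_invariant m S \<longleftrightarrow> translate (int m) ` S = S"

definition block_orbits :: "nat \<Rightarrow> int set set \<Rightarrow> int set set set" where
  "block_orbits m S = (\<lambda>B. {translate (k * int m) B | k. True}) ` S"

text \<open>
  The drawing has the blocks of size two of \<open>P\<close> as arcs below the line and the marked singletons
  in \<open>M\<close> as rays going down. Two arcs cross iff their endpoints interleave, and a ray crosses an
  arc iff it starts strictly between the endpoints of the arc. Unmarked singletons draw nothing.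
\<close>

definition planar :: "int set set \<Rightarrow> int set set \<Rightarrow> bool" where
  "planar P M \<longleftrightarrow>
     (\<forall>a b c d. {a, b} \<in> P \<longrightarrow> {c, d} \<in> P \<longrightarrow> \<not> (a < c \<and> c < b \<and> b < d)) \<and>
     (\<forall>a b c. {a, b} \<in> P \<longrightarrow> {c} \<in> M \<longrightarrow> \<not> (a < c \<and> c < b))"

fun admissible :: "diagram_type \<Rightarrow> int set set \<Rightarrow> int set set \<Rightarrow> bool" where
  "admissible TL P M \<longleftrightarrow> (\<forall>B\<in>P - M. card B = 2) \<and> planar P M"
| "admissible Mo P M \<longleftrightarrow> (\<forall>B\<in>P - M. card B = 1 \<or> card B = 2) \<and> planar P M"
| "admissible PRo P M \<longleftrightarrow> (\<forall>B\<in>P. card B = 1)"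
| "admissible Ro P M \<longleftrightarrow> (\<forall>B\<in>P. card B = 1)"

text \<open>
  A top half is a pair \<open>(P, M)\<close> of a partition \<open>P\<close> of the integers and the set \<open>M\<close> of its marked
  blocks, which are the upper ends of the through lines. It depends only on the diagram type, so the
  affine, periodic and reduced algebras of one type share the same top sets. The condition
  \<open>finite B\<close> is needed because infinite sets have \<open>card\<close> equal to 0.
\<close>

definition top_set :: "diagram_type \<Rightarrow> nat \<Rightarrow> nat \<Rightarrow> (int set set \<times> int set set) set" where
  "top_set T m l =
     {(P, M). partition_on UNIV P \<and> (\<forall>B\<in>P. finite B \<and> card B \<le> 2) \<and>
        translation_invariant m P \<and>
        M \<subseteq> P \<and> (\<forall>B\<in>M. card B = 1) \<and> translation_invariant m M \<and>
        card (block_orbits m M) = l \<and>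
        admissible T P M}"

end

theory Submission
  imports Defs
begin

text \<open>
  Read a planar top half as a periodic word on \<open>\<int>\<close>: every integer is the right end of an arc (a
  closer), an isolated point, or one of the rest, which are the left ends of arcs (openers) and the
  starts of rays. The word does not say which of the rest are openers, yet it determines the top
  half, because planarity matches parentheses: each closer must be joined to the nearest free
  opener on its left, and what is never matched is a ray. So a planar top half is determined
  by a pair \<open>(c, i)\<close> of disjoint subsets of one period \<open>{0..<m}\<close>, the closers and the isolated
  points.

  An arc pairs an opener with a closer in a translation-invariant way, so a period contains as many
  openers as closers. Hence the number \<open>l\<close> of rays per period is the remainder in
  \<open>|i| + 2 |c| + l = m\<close> (\<open>planar_top.period_count\<close>), and \<open>T(l)\<close> corresponds to exactly the pairs
  satisfying this equation (\<open>bij_betw_period_word\<close>).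

  Uniqueness of the top half with a given word is an induction on the length of an arc
  (\<open>arc_transfer\<close>). Existence uses the height function of the word, a lattice path that goes down at
  closers, stays level at isolated points and goes up elsewhere; arcs join an up step to the down
  step at which the path first returns to its old height. The path climbs by \<open>l \<ge> 0\<close> in each
  period, so going back one period from a down step always reaches a height at which to match it
  (\<open>height_function.down_closes\<close>).

  Choosing first the \<open>j\<close> closers and then the isolated points among the other \<open>m - j\<close> points gives
  the sum for type \<open>Mo\<close>, which also arises by expanding \<open>(t\<^sup>2 + (1 + t))\<^sup>m\<close> by the binomial theorem.
  Type \<open>TL\<close> is the case without isolated points, where only the set of \<open>(m - l) / 2\<close> closers
  remains to be chosen. For the two rook types the partition is forced to consist of singletons, and
  the choice is that of the \<open>l\<close> marked residues.
\<close>

section \<open>Periodic sets of integers\<close>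

definition periodic :: "nat \<Rightarrow> int set \<Rightarrow> bool" where
  "periodic m A \<longleftrightarrow> (\<forall>x. x + int m \<in> A \<longleftrightarrow> x \<in> A)"

abbreviation period :: "nat \<Rightarrow> int set" where
  "period m \<equiv> {0..<int m}"

lemma shift_invariant_multiple:
  fixes Q :: "int \<Rightarrow> bool"
  assumes "\<And>x. Q (x + int m) \<longleftrightarrow> Q x"
  shows "Q (x + k * int m) \<longleftrightarrow> Q x"
proof (induction k rule: int_induct[where k = 0])
  case base
  then show ?case by simp
next
  case (step1 i)
  then show ?case using assms[of "x + i * int m"] by (simp add: algebra_simps)
next
  case (step2 i)
  then show ?case using assms[of "x + (i - 1) * int m"] by (simp add: algebra_simps)
qed

lemma shift_invariant_mod:
  fixes Q :: "int \<Rightarrow> bool"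
  assumes "\<And>x. Q (x + int m) \<longleftrightarrow> Q x"
  shows "Q (x mod int m) \<longleftrightarrow> Q x"
  using shift_invariant_multiple[of Q m "x mod int m" "x div int m", OF assms]
  by simp

lemma periodic_mod: "periodic m A \<Longrightarrow> x mod int m \<in> A \<longleftrightarrow> x \<in> A"
  using shift_invariant_mod[of "\<lambda>x. x \<in> A"] by (simp add: periodic_def)

lemma mod_in_period: "1 \<le> m \<Longrightarrow> x mod int m \<in> period m"
  by simp

lemma periodic_eqI:
  assumes "1 \<le> m" "periodic m A" "periodic m B" "A \<inter> period m = B \<inter> period m"
  shows "A = B"
proof (rule set_eqI)
  fix x
  have "x mod int m \<in> A \<longleftrightarrow> x mod int m \<in> B"
    using assms(4) mod_in_period[OF assms(1), of x] by blast
  then show "x \<in> A \<longleftrightarrow> x \<in> B"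
    using periodic_mod[OF assms(2)] periodic_mod[OF assms(3)] by simp
qed

definition periodic_extension :: "nat \<Rightarrow> int set \<Rightarrow> int set" where
  "periodic_extension m c = {x. x mod int m \<in> c}"

lemma periodic_periodic_extension: "periodic m (periodic_extension m c)"
  by (simp add: periodic_def periodic_extension_def)

lemma periodic_extension_period:
  "c \<subseteq> period m \<Longrightarrow> periodic_extension m c \<inter> period m = c"
  by (auto simp: periodic_extension_def)

text \<open>
  Reducing the partner of \<open>a\<close> modulo \<open>m\<close> stays injective on one period: if the partners of \<open>a\<close> and
  \<open>a'\<close> are congruent, translating one related pair onto the other makes \<open>a\<close> and \<open>a'\<close> congruent
  as well. Used for arcs in both directions, this shows that a period has as many openers as closers.
\<close>

lemma card_domain_period_le:
  fixes R :: "int \<Rightarrow> int \<Rightarrow> bool"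
  assumes m: "1 \<le> m"
    and shift: "\<And>a b. R (a + int m) (b + int m) \<longleftrightarrow> R a b"
    and inj: "\<And>a a' b. R a b \<Longrightarrow> R a' b \<Longrightarrow> a = a'"
  shows "card ({a. \<exists>b. R a b} \<inter> period m) \<le> card ({b. \<exists>a. R a b} \<inter> period m)"
proof -
  have shifts: "R (a + k * int m) (b + k * int m) \<longleftrightarrow> R a b" for a b k
  proof -
    have "R (a + (x + int m)) (b + (x + int m)) \<longleftrightarrow> R (a + x) (b + x)" for x
      using shift[of "a + x" "b + x"] by (simp add: algebra_simps)
    then show ?thesis
      using shift_invariant_multiple[of "\<lambda>x. R (a + x) (b + x)" m 0 k]
      by simp
  qed
  define f where "f a = (SOME b. R a b)" for a
  have f: "R a (f a)" if "\<exists>b. R a b" for a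
    unfolding f_def using that by (rule someI_ex)
  have "inj_on (\<lambda>a. f a mod int m) ({a. \<exists>b. R a b} \<inter> period m)"
  proof (rule inj_onI)
    fix a a'
    assume a: "a \<in> {a. \<exists>b. R a b} \<inter> period m" and a': "a' \<in> {a. \<exists>b. R a b} \<inter> period m"
      and eq: "f a mod int m = f a' mod int m"
    obtain k where k: "f a' = f a + k * int m"
      using eq by (metis mod_eqE mult.commute)
    have "R (a + k * int m) (f a')"
      using shifts[of a k "f a"] f[of a] a k by auto
    then have "a' = a + k * int m"
      using inj f[of a'] a' by blast
    then have "a' mod int m = a mod int m"
      by simp
    then show "a = a'"
      using a a' by simp
  qed
  moreover have "(\<lambda>a. f a mod int m) ` ({a. \<exists>b. R a b} \<inter> period m)
      \<subseteq> {b. \<exists>a. R a b} \<inter> period m"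
  proof safe
    fix a b assume "R a b"
    then have "R a (f a)" using f by blast
    then have "R (a + - (f a div int m) * int m) (f a + - (f a div int m) * int m)"
      using shifts by blast
    moreover have "f a + - (f a div int m) * int m = f a mod int m"
      by (simp add: minus_div_mult_eq_mod)
    ultimately show "\<exists>a'. R a' (f a mod int m)" by metis
    show "f a mod int m \<in> period m" using m by simp
  qed
  ultimately show ?thesis
    by (intro card_inj_on_le) auto
qed

section \<open>Translation-invariant families of blocks\<close>

lemma translate_insert [simp]: "translate k (insert a B) = insert (a + k) (translate k B)"
  by (simp add: translate_def)

lemma translate_empty [simp]: "translate k {} = {}"
  by (simp add: translate_def)

lemma translate_back [simp]: "translate (- k) (translate k B) = B"
  by (simp add: translate_def image_image)

lemma translate_forth: "translate k (translate (- k) B) = B"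
  by (simp add: translate_def image_image)

lemma translation_invariantD:
  assumes "translation_invariant m S"
  shows "translate (int m) B \<in> S \<longleftrightarrow> B \<in> S"
proof -
  have "inj (translate (int m))"
    by (rule inj_on_inverseI) (rule translate_back)
  then have "translate (int m) B \<in> translate (int m) ` S \<longleftrightarrow> B \<in> S"
    by (rule inj_image_mem_iff)
  then show ?thesis
    using assms by (simp add: translation_invariant_def)
qed

lemma translation_invariantI:
  assumes "\<And>B. translate (int m) B \<in> S \<longleftrightarrow> B \<in> S"
  shows "translation_invariant m S"
  unfolding translation_invariant_def
proof (rule set_eqI)
  fix B
  show "B \<in> translate (int m) ` S \<longleftrightarrow> B \<in> S"
    using assms[of "translate (- int m) B"] assms translate_forth[of "int m" B]
    by (auto intro: rev_image_eqI)
qed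

definition marked :: "int set set \<Rightarrow> int set" where
  "marked M = {x. {x} \<in> M}"

lemma singletons_marked: "(\<forall>B\<in>M. card B = 1) \<Longrightarrow> M = (\<lambda>x. {x}) ` marked M"
proof (intro equalityI subsetI)
  fix B assume "\<forall>B\<in>M. card B = 1" "B \<in> M"
  then obtain x where "B = {x}" by (auto simp: card_1_singleton_iff)
  then show "B \<in> (\<lambda>x. {x}) ` marked M" using \<open>B \<in> M\<close> by (simp add: marked_def)
qed (auto simp: marked_def)

lemma marked_singletons: "marked ((\<lambda>x. {x}) ` A) = A"
  by (auto simp: marked_def)

lemma periodic_marked: "translation_invariant m M \<Longrightarrow> periodic m (marked M)"
  using translation_invariantD[of m M "{x}" for x] by (simp add: periodic_def marked_def)

lemma translation_invariant_singletons:
  assumes "periodic m A"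
  shows "translation_invariant m ((\<lambda>x. {x}) ` A)"
proof (rule translation_invariantI)
  fix B
  have "translate (int m) B = {y} \<longleftrightarrow> B = {y - int m}" for y
  proof
    assume "translate (int m) B = {y}"
    then have "translate (- int m) (translate (int m) B) = {y - int m}" by simp
    then show "B = {y - int m}" by (simp only: translate_back)
  qed simp
  moreover have "y - int m \<in> A \<longleftrightarrow> y \<in> A" for y
    using assms unfolding periodic_def by (metis diff_add_cancel)
  ultimately show "translate (int m) B \<in> (\<lambda>x. {x}) ` A \<longleftrightarrow> B \<in> (\<lambda>x. {x}) ` A"
    by (auto simp: image_iff) (metis add_diff_cancel_right' singleton_iff)
qed

text \<open>
  Each orbit of marked singletons meets the period in exactly one point, by division with remainder.
\<close>

lemma card_block_orbits:
  assumes m: "1 \<le> m" and singles: "\<forall>B\<in>M. card B = 1" and inv: "translation_invariant m M"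
  shows "card (block_orbits m M) = card (marked M \<inter> period m)"
proof -
  define orb where "orb x = {translate (k * int m) {x} | k. True}" for x :: int
  have orb: "orb x = {{x + k * int m} | k. True}" for x
    by (simp add: orb_def)
  have "block_orbits m M = orb ` marked M"
    unfolding block_orbits_def orb_def
    by (subst singletons_marked[OF singles]) (simp add: image_image)
  also have "\<dots> = orb ` (marked M \<inter> period m)"
  proof -
    have "orb x = orb (x mod int m)" for x
    proof -
      have "x + k * int m = x mod int m + (k + x div int m) * int m"
        "x mod int m + k * int m = x + (k - x div int m) * int m" for k
        by (simp_all add: algebra_simps minus_div_mult_eq_mod flip: minus_mod_eq_div_mult)
      then show ?thesis unfolding orb by blast
    qed
    then show ?thesis
      using periodic_mod[OF periodic_marked[OF inv]] mod_in_period[OF m]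
      by (auto simp: image_iff) (metis IntI mod_in_period[OF m])
  qed
  also have "card \<dots> = card (marked M \<inter> period m)"
  proof (intro card_image inj_onI)
    fix x y assume x: "x \<in> marked M \<inter> period m" and y: "y \<in> marked M \<inter> period m"
      and "orb x = orb y"
    then have "{x + 0 * int m} \<in> orb y" unfolding orb by blast
    then obtain k where "x = y + k * int m" unfolding orb by auto
    then have "x mod int m = y mod int m" by simp
    then show "x = y" using x y by simp
  qed
  finally show ?thesis .
qed

section \<open>Planar top halves and their words\<close>

definition openers :: "int set set \<Rightarrow> int set" where
  "openers P = {a. \<exists>b. a < b \<and> {a, b} \<in> P}"

definition closers :: "int set set \<Rightarrow> int set" where
  "closers P = {b. \<exists>a. a < b \<and> {a, b} \<in> P}"

definition isolated :: "int set set \<Rightarrow> int set set \<Rightarrow> int set" where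
  "isolated P M = {x. {x} \<in> P - M}"

locale planar_top =
  fixes m :: nat and P M :: "int set set"
  assumes partition: "partition_on UNIV P"
    and small: "\<And>B. B \<in> P \<Longrightarrow> finite B \<and> card B \<le> 2"
    and invariant: "translation_invariant m P"
    and marked_blocks: "M \<subseteq> P"
    and marked_single: "\<And>B. B \<in> M \<Longrightarrow> card B = 1"
    and marked_invariant: "translation_invariant m M"
    and planar: "planar P M"
begin

lemma block_unique: "B \<in> P \<Longrightarrow> B' \<in> P \<Longrightarrow> x \<in> B \<Longrightarrow> x \<in> B' \<Longrightarrow> B = B'"
  using partition by (auto simp: partition_on_def disjoint_def)

lemma block_exists: obtains B where "B \<in> P" "x \<in> B"
  using partition by (auto simp: partition_on_def)

lemma block_cases:
  assumes "B \<in> P"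
  obtains x where "B = {x}" | a b where "a < b" "B = {a, b}"
proof -
  have "B \<noteq> {}" using partition assms by (auto simp: partition_on_def)
  then have "card B = 1 \<or> card B = 2"
    using small[OF assms] by (metis One_nat_def Suc_1 Suc_leI card_gt_0_iff le_antisym not_less_eq_eq)
  then show thesis
  proof
    assume "card B = 1"
    then show thesis using that(1) by (auto simp: card_1_singleton_iff)
  next
    assume "card B = 2"
    then obtain a b where "B = {a, b}" "a \<noteq> b" by (auto simp: card_2_iff)
    then show thesis using that(2)[of a b] that(2)[of b a]
      by (metis insert_commute linorder_neqE)
  qed
qed

lemma arc_left_unique: "{a, b} \<in> P \<Longrightarrow> {a', b} \<in> P \<Longrightarrow> a < b \<Longrightarrow> a' < b \<Longrightarrow> a = a'"
  using block_unique[of "{a, b}" "{a', b}" b] by (auto simp: doubleton_eq_iff)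

lemma arc_right_unique: "{a, b} \<in> P \<Longrightarrow> {a, b'} \<in> P \<Longrightarrow> b = b'"
  using block_unique[of "{a, b}" "{a, b'}" a] by (auto simp: doubleton_eq_iff)

lemma no_crossing: "{a, b} \<in> P \<Longrightarrow> {c, d} \<in> P \<Longrightarrow> a < c \<Longrightarrow> c < b \<Longrightarrow> d \<le> b"
  using planar unfolding planar_def by (meson not_le)

lemma no_ray_under_arc: "{a, b} \<in> P \<Longrightarrow> a < c \<Longrightarrow> c < b \<Longrightarrow> c \<notin> marked M"
  using planar by (auto simp: planar_def marked_def)

lemma point_cases: "x \<in> openers P \<or> x \<in> closers P \<or> x \<in> isolated P M \<or> x \<in> marked M"
proof -
  obtain B where B: "B \<in> P" "x \<in> B" by (rule block_exists)
  show ?thesis using B(1)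
    by (cases rule: block_cases)
      (use B in \<open>auto simp: openers_def closers_def isolated_def marked_def\<close>)
qed

lemma marked_block: "x \<in> marked M \<Longrightarrow> {x} \<in> P"
  using marked_blocks by (auto simp: marked_def)

lemma points_disjoint:
  "openers P \<inter> closers P = {}" "openers P \<inter> isolated P M = {}" "openers P \<inter> marked M = {}"
  "closers P \<inter> isolated P M = {}" "closers P \<inter> marked M = {}" "isolated P M \<inter> marked M = {}"
proof -
  have *: False if "{x} \<in> P" "{x, y} \<in> P" "x \<noteq> y" for x y
    using block_unique[of "{x}" "{x, y}" x] that by auto
  have **: False if "{x, y} \<in> P" "{z, x} \<in> P" "x < y" "z < x" for x y z
    using block_unique[of "{x, y}" "{z, x}" x] that by (auto simp: doubleton_eq_iff)
  show "openers P \<inter> closers P = {}"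
    using ** by (auto simp: openers_def closers_def)
  show "openers P \<inter> isolated P M = {}"
    using * by (force simp: openers_def isolated_def)
  show "openers P \<inter> marked M = {}"
    using * marked_block by (force simp: openers_def)
  show "closers P \<inter> isolated P M = {}"
    using * by (force simp: closers_def isolated_def insert_commute)
  show "closers P \<inter> marked M = {}"
    using * marked_block by (force simp: closers_def insert_commute)
  show "isolated P M \<inter> marked M = {}"
    by (auto simp: isolated_def marked_def)
qed

lemma openers_or_marked: "openers P \<union> marked M = - (closers P \<union> isolated P M)"
proof (rule set_eqI)
  fix x
  show "x \<in> openers P \<union> marked M \<longleftrightarrow> x \<in> - (closers P \<union> isolated P M)"
    using point_cases[of x] points_disjoint by auto
qed

lemma marked_eq: "marked M = - (closers P \<union> isolated P M) - openers P"
  using openers_or_marked points_disjoint(3) by blast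

lemma arc_shift: "{a + int m, b + int m} \<in> P \<longleftrightarrow> {a, b} \<in> P"
  using translation_invariantD[OF invariant, of "{a, b}"] by simp

lemma periodic_closers: "periodic m (closers P)"
  unfolding periodic_def
proof
  fix x
  show "x + int m \<in> closers P \<longleftrightarrow> x \<in> closers P"
  proof
    assume "x + int m \<in> closers P"
    then obtain a where a: "a < x + int m" "{a, x + int m} \<in> P" by (auto simp: closers_def)
    then have "{a - int m, x} \<in> P" using arc_shift[of "a - int m" x] by simp
    moreover have "a - int m < x" using a by simp
    ultimately show "x \<in> closers P" by (auto simp: closers_def)
  next
    assume "x \<in> closers P"
    then obtain a where a: "a < x" "{a, x} \<in> P" by (auto simp: closers_def)
    then have "{a + int m, x + int m} \<in> P" "a + int m < x + int m" by (simp_all add: arc_shift)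
    then show "x + int m \<in> closers P" unfolding closers_def by blast
  qed
qed

lemma periodic_isolated: "periodic m (isolated P M)"
  using arc_shift[of x x for x] translation_invariantD[OF marked_invariant, of "{x}" for x]
  by (simp add: periodic_def isolated_def)

lemma card_openers_eq_card_closers:
  assumes "1 \<le> m"
  shows "card (openers P \<inter> period m) = card (closers P \<inter> period m)"
proof (rule antisym)
  let ?R = "\<lambda>a b. a < b \<and> {a, b} \<in> P"
  show "card (openers P \<inter> period m) \<le> card (closers P \<inter> period m)"
    unfolding openers_def closers_def
    by (rule card_domain_period_le[of m ?R])
      (use assms arc_shift arc_left_unique in \<open>auto\<close>)
  show "card (closers P \<inter> period m) \<le> card (openers P \<inter> period m)"
    unfolding openers_def closers_def
    by (rule card_domain_period_le[of m "\<lambda>b a. ?R a b"])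
      (use assms arc_shift arc_right_unique in \<open>auto\<close>)
qed

text \<open>
  The points of a period are openers, closers, isolated or marked, and there are as many openers as
  closers.
\<close>

lemma period_count:
  assumes "1 \<le> m"
  shows "card (isolated P M \<inter> period m) + 2 * card (closers P \<inter> period m)
    + card (marked M \<inter> period m) = m"
proof -
  let ?c = "\<lambda>A. A \<inter> period m"
  have "period m = (?c (openers P) \<union> ?c (closers P)) \<union> (?c (isolated P M) \<union> ?c (marked M))"
    using point_cases by blast
  then have "m = card ((?c (openers P) \<union> ?c (closers P)) \<union> (?c (isolated P M) \<union> ?c (marked M)))"
    by (metis card_atLeastZeroLessThan_int nat_int)
  also have "\<dots> = card (?c (openers P) \<union> ?c (closers P)) + card (?c (isolated P M) \<union> ?c (marked M))"
    by (rule card_Un_disjoint) (use points_disjoint in auto)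
  also have "card (?c (openers P) \<union> ?c (closers P)) = card (?c (openers P)) + card (?c (closers P))"
    by (rule card_Un_disjoint) (use points_disjoint in auto)
  also have "card (?c (isolated P M) \<union> ?c (marked M)) = card (?c (isolated P M)) + card (?c (marked M))"
    by (rule card_Un_disjoint) (use points_disjoint in auto)
  finally show ?thesis
    using card_openers_eq_card_closers[OF assms] by simp
qed

end

text \<open>
  Suppose \<open>{a, b}\<close> is an arc of \<open>P\<close>, and that in \<open>P'\<close> the closer \<open>b\<close> is joined to some
  \<open>a' \<noteq> a\<close>. The inner one of \<open>a\<close> and \<open>a'\<close> lies under the arc that the other one forms with
  \<open>b\<close>. In that diagram it is therefore not a ray, so it opens an arc, which ends before \<open>b\<close>. If the
  inner point is \<open>a'\<close>, this arc of \<open>P\<close> belongs to \<open>P'\<close> by induction on the length, and \<open>a'\<close> has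
  two partners in \<open>P'\<close>. If it is \<open>a\<close>, the closer at the end of the arc has a partner in \<open>P\<close>
  strictly inside \<open>{a, b}\<close>; by induction that shorter arc belongs to \<open>P'\<close>, where the closer then
  has two partners.
\<close>

lemma arc_transfer:
  assumes "planar_top m P M" "planar_top m P' M'"
    and c: "closers P = closers P'" and i: "isolated P M = isolated P' M'"
  shows "a < b \<Longrightarrow> {a, b} \<in> P \<Longrightarrow> {a, b} \<in> P'"
proof (induction "nat (b - a)" arbitrary: a b rule: less_induct)
  case less
  interpret T: planar_top m P M by fact
  interpret T': planar_top m P' M' by fact
  \<comment> \<open>The word does not separate openers from rays; what the diagrams share is their union.\<close>
  have open_iff: "x \<in> openers P \<union> marked M \<longleftrightarrow> x \<in> openers P' \<union> marked M'" for x
    by (simp only: T.openers_or_marked T'.openers_or_marked c i)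
  obtain a' where a': "a' < b" "{a', b} \<in> P'"
    using less.prems c by (auto simp: closers_def)
  consider "a' = a" | "a' < a" | "a < a'" by linarith
  then show ?case
  proof cases
    case 1
    then show ?thesis using a' by simp
  next
    case 2
    have "a \<in> openers P" using less.prems by (auto simp: openers_def)
    then have "a \<in> openers P'"
      using open_iff T'.no_ray_under_arc[OF a'(2)] 2 less.prems by blast
    then obtain b' where b': "a < b'" "{a, b'} \<in> P'" by (auto simp: openers_def)
    have "b' \<noteq> b" using b' a' 2 T'.arc_left_unique by fastforce
    then have "b' < b"
      using T'.no_crossing[OF a'(2) b'(2)] 2 less.prems by simp
    have "b' \<in> closers P" using b' c by (auto simp: closers_def)
    then obtain a'' where a'': "a'' < b'" "{a'', b'} \<in> P" by (auto simp: closers_def)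
    \<comment> \<open>In \<open>P\<close> the closer \<open>b'\<close> is joined to some \<open>a''\<close> strictly inside \<open>{a, b}\<close>, since \<open>a\<close> is taken.\<close>
    have "a'' \<noteq> a" using a'' less.prems T.arc_right_unique \<open>b' < b\<close> by blast
    moreover have "\<not> a'' < a"
      using T.no_crossing[OF a''(2) less.prems(2)] b' \<open>b' < b\<close> by auto
    ultimately have "a < a''" by simp
    then have "{a'', b'} \<in> P'"
      using less.hyps[of b' a''] a'' \<open>b' < b\<close> less.prems by auto
    then show ?thesis
      using T'.arc_left_unique[OF _ b'(2)] a'' b' \<open>a < a''\<close> by fastforce
  next
    case 3
    have "a' \<in> openers P'" using a' by (auto simp: openers_def)
    then have "a' \<in> openers P"
      using open_iff T.no_ray_under_arc[OF less.prems(2)] 3 a' by blast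
    then obtain b'' where b'': "a' < b''" "{a', b''} \<in> P" by (auto simp: openers_def)
    have "b'' \<noteq> b" using b'' less.prems 3 T.arc_left_unique a' by fastforce
    then have "b'' < b" using T.no_crossing[OF less.prems(2) b''(2)] 3 a' by simp
    then have "{a', b''} \<in> P'"
      using less.hyps[of b'' a'] b'' 3 by auto
    then show ?thesis using T'.arc_right_unique a' \<open>b'' < b\<close> by blast
  qed
qed

text \<open>
  Equal arcs leave equal sets of points outside arcs; the isolated ones among these agree by
  assumption, so the marked ones agree too.
\<close>

lemma block_transfer:
  assumes T: "planar_top m P M" and T': "planar_top m P' M'"
    and c: "closers P = closers P'" and i: "isolated P M = isolated P' M'"
  shows "P \<subseteq> P'" and "M \<subseteq> M'"
proof -
  interpret T: planar_top m P M by fact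
  interpret T': planar_top m P' M' by fact
  have "openers P = openers P'"
    using arc_transfer[OF T T' c i] arc_transfer[OF T' T c[symmetric] i[symmetric]]
    by (auto simp: openers_def)
  then have marks: "marked M = marked M'"
    by (simp only: T.marked_eq T'.marked_eq c i)
  then show "M \<subseteq> M'"
    using singletons_marked[of M] singletons_marked[of M'] T.marked_single T'.marked_single by auto
  show "P \<subseteq> P'"
  proof
    fix B assume "B \<in> P"
    then show "B \<in> P'"
    proof (cases rule: T.block_cases)
      case (1 x)
      then have "x \<in> isolated P M \<or> x \<in> marked M"
        using \<open>B \<in> P\<close> by (auto simp: isolated_def marked_def)
      then show ?thesis
        using 1 i marks T'.marked_block by (auto simp: isolated_def)
    next
      case (2 a b)
      then show ?thesis using arc_transfer[OF T T' c i] \<open>B \<in> P\<close> by simp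
    qed
  qed
qed

section \<open>The top half of a height function\<close>

text \<open>
  The lattice path of a word: it steps down at closers, stays level at isolated points and steps up
  at all other points. The values of \<open>h\<close> live between the points, \<open>h x\<close> just before \<open>x\<close> and
  \<open>h (x + 1)\<close> just after it.
\<close>

locale height_function =
  fixes m l :: nat and h :: "int \<Rightarrow> int"
  assumes step: "\<bar>h (x + 1) - h x\<bar> \<le> 1"
    and climb: "h (x + int m) = h x + int l"
    and m_pos: "1 \<le> m"
begin

text \<open>
  The step at \<open>b\<close> brings the path back, for the first time, to its height before the step at \<open>a\<close>.
\<close>

definition arc :: "int \<Rightarrow> int \<Rightarrow> bool" where
  "arc a b \<longleftrightarrow> a < b \<and> h (b + 1) = h a \<and> (\<forall>y. a < y \<and> y \<le> b \<longrightarrow> h a < h y)"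

definition ray :: "int \<Rightarrow> bool" where
  "ray x \<longleftrightarrow> h x < h (x + 1) \<and> (\<forall>b. \<not> arc x b)"

definition blocks :: "int set set" where
  "blocks = {{a, b} | a b. arc a b} \<union> {{x} | x. \<forall>y. \<not> arc x y \<and> \<not> arc y x}"

definition rays :: "int set set" where
  "rays = {{x} | x. ray x}"

lemma arc_up: "arc a b \<Longrightarrow> h a < h (a + 1)"
  by (simp add: arc_def)

lemma arc_down: "arc a b \<Longrightarrow> h (b + 1) < h b"
  by (simp add: arc_def)

lemma arc_less: "arc a b \<Longrightarrow> a < b"
  by (simp add: arc_def)

lemma arc_above: "arc a b \<Longrightarrow> a < y \<Longrightarrow> y \<le> b \<Longrightarrow> h a < h y"
  by (simp add: arc_def)

lemma arc_functional:
  assumes "arc a b" "arc a b'" shows "b = b'"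
proof -
  have "\<not> b < b'" "\<not> b' < b"
    using assms unfolding arc_def by (smt (verit))+
  then show ?thesis by simp
qed

lemma arc_injective:
  assumes "arc a b" "arc a' b" shows "a = a'"
proof -
  have "\<not> a < a'" "\<not> a' < a"
    using assms unfolding arc_def by (smt (verit))+
  then show ?thesis by simp
qed

lemma arc_not_chained: "arc a b \<Longrightarrow> \<not> arc b c"
  using arc_up arc_down by fastforce

lemma arc_shift: "arc (a + int m) (b + int m) \<longleftrightarrow> arc a b"
proof -
  have "(\<forall>y. a + int m < y \<and> y \<le> b + int m \<longrightarrow> h (a + int m) < h y) \<longleftrightarrow>
      (\<forall>y. a < y \<and> y \<le> b \<longrightarrow> h a < h y)" (is "?L \<longleftrightarrow> ?R")
  proof
    assume ?L
    show ?R
    proof (intro allI impI)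
      fix y assume "a < y \<and> y \<le> b"
      then show "h a < h y"
        using \<open>?L\<close>[rule_format, of "y + int m"] by (simp add: climb)
    qed
  next
    assume ?R
    show ?L
    proof (intro allI impI)
      fix y assume "a + int m < y \<and> y \<le> b + int m"
      then show "h (a + int m) < h y"
        using \<open>?R\<close>[rule_format, of "y - int m"] climb[of "y - int m"] climb[of a] by simp
    qed
  qed
  moreover have "h (b + int m + 1) = h (b + 1) + int l"
    using climb[of "b + 1"] by (simp add: algebra_simps)
  ultimately show ?thesis
    by (simp add: arc_def climb)
qed

lemma arc_shift_left: "(\<exists>b. arc (x + int m) b) \<longleftrightarrow> (\<exists>b. arc x b)"
proof
  assume "\<exists>b. arc (x + int m) b"
  then obtain b where "arc (x + int m) b" ..
  then have "arc x (b - int m)" using arc_shift[of x "b - int m"] by simp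
  then show "\<exists>b. arc x b" ..
next
  assume "\<exists>b. arc x b"
  then show "\<exists>b. arc (x + int m) b" using arc_shift[of x] by blast
qed

lemma arc_shift_right: "(\<exists>a. arc a (x + int m)) \<longleftrightarrow> (\<exists>a. arc a x)"
proof
  assume "\<exists>a. arc a (x + int m)"
  then obtain a where "arc a (x + int m)" ..
  then have "arc (a - int m) x" using arc_shift[of "a - int m" x] by simp
  then show "\<exists>a. arc a x" ..
next
  assume "\<exists>a. arc a x"
  then show "\<exists>a. arc a (x + int m)" using arc_shift[of _ x] by blast
qed

text \<open>
  The partner of a down step at \<open>b\<close> is the last position before it at height at most
  \<open>h (b + 1)\<close>. One exists within the preceding period, because \<open>h (b + 1 - m) = h (b + 1) - l\<close>, and
  since steps have size at most 1 the last one has height exactly \<open>h (b + 1)\<close>.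
\<close>

lemma down_closes:
  assumes down: "h (b + 1) < h b"
  obtains a where "arc a b"
proof -
  define S where "S = {b + 1 - int m..b} \<inter> {a. h a \<le> h (b + 1)}"
  define a where "a = Max S"
  have "finite S" by (simp add: S_def)
  have "b + 1 - int m \<in> S"
    using climb[of "b + 1 - int m"] m_pos by (simp add: S_def)
  then have "a \<in> S" using \<open>finite S\<close> unfolding a_def by (intro Max_in) auto
  then have a: "h a \<le> h (b + 1)" "a \<le> b" "b + 1 - int m \<le> a" by (simp_all add: S_def)
  then have "a < b" using down by (cases "a = b") auto
  have above: "h (b + 1) < h y" if "a < y" "y \<le> b" for y
  proof (rule ccontr)
    assume "\<not> ?thesis"
    then have "y \<in> S" using that a by (simp add: S_def)
    then show False using Max_ge[OF \<open>finite S\<close>] that a_def by fastforce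
  qed
  have "h a = h (b + 1)"
    using above[of "a + 1"] step[of a] a \<open>a < b\<close> by simp
  then have "arc a b" using above \<open>a < b\<close> by (simp add: arc_def)
  then show thesis by (rule that)
qed

text \<open>
  The discrete intermediate value argument for the first return. It excludes a ray under an arc: the
  path has to come down again before the arc closes.
\<close>

lemma up_opens:
  assumes up: "h c < h (c + 1)" and "c < z" "h z \<le> h c"
  obtains b where "arc c b"
proof -
  define S where "S = {c<..z} \<inter> {y. h y \<le> h c}"
  define y where "y = Min S"
  have "finite S" by (simp add: S_def)
  have "z \<in> S" using assms by (simp add: S_def)
  then have "y \<in> S" using \<open>finite S\<close> unfolding y_def by (intro Min_in) auto
  then have y: "h y \<le> h c" "c < y" "y \<le> z" by (simp_all add: S_def)
  have above: "h c < h x" if "c < x" "x < y" for x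
  proof (rule ccontr)
    assume "\<not> ?thesis"
    then have "x \<in> S" using that y by (simp add: S_def)
    then show False using Min_le[OF \<open>finite S\<close>] that y_def by fastforce
  qed
  have "y \<noteq> c + 1" using up y by auto
  then have "c < y - 1" using y by simp
  then have "h y = h c" using above[of "y - 1"] step[of "y - 1"] y by simp
  then have "arc c (y - 1)" using above \<open>c < y - 1\<close> by (simp add: arc_def)
  then show thesis by (rule that)
qed

lemma pair_in_blocks: "a < b \<Longrightarrow> {a, b} \<in> blocks \<longleftrightarrow> arc a b"
  by (auto simp: blocks_def doubleton_eq_iff dest: arc_less)

lemma single_in_blocks: "{x} \<in> blocks \<longleftrightarrow> (\<forall>y. \<not> arc x y \<and> \<not> arc y x)"
  by (auto simp: blocks_def dest: arc_less)

lemma single_in_rays: "{x} \<in> rays \<longleftrightarrow> ray x"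
  by (auto simp: rays_def)

lemma closers_blocks: "closers blocks = {x. h (x + 1) < h x}"
proof -
  have "x \<in> closers blocks \<longleftrightarrow> (\<exists>a. arc a x)" for x
    using pair_in_blocks arc_less unfolding closers_def by blast
  moreover have "(\<exists>a. arc a x) \<longleftrightarrow> h (x + 1) < h x" for x
    using down_closes[of x] arc_down[of _ x] by auto
  ultimately show ?thesis by auto
qed

lemma isolated_blocks: "isolated blocks rays = {x. h (x + 1) = h x}"
proof -
  have "x \<in> isolated blocks rays \<longleftrightarrow> h (x + 1) = h x" for x
  proof
    assume "x \<in> isolated blocks rays"
    then have "\<not> arc x y" "\<not> arc y x" "\<not> ray x" for y
      using single_in_blocks single_in_rays by (auto simp: isolated_def)
    then show "h (x + 1) = h x"
      using down_closes[of x] unfolding ray_def by (meson linorder_neqE)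
  next
    assume "h (x + 1) = h x"
    then have "\<not> arc x y" "\<not> arc y x" "\<not> ray x" for y
      using arc_up[of x y] arc_down[of y x] by (auto simp: ray_def)
    then show "x \<in> isolated blocks rays"
      using single_in_blocks single_in_rays by (simp add: isolated_def)
  qed
  then show ?thesis by blast
qed

lemma ray_shift: "ray (x + int m) \<longleftrightarrow> ray x"
proof -
  have "(\<forall>b. \<not> arc (x + int m) b) \<longleftrightarrow> (\<forall>b. \<not> arc x b)"
    using arc_shift_left by blast
  moreover have "h (x + int m + 1) = h (x + 1) + int l"
    using climb[of "x + 1"] by (simp add: algebra_simps)
  ultimately show ?thesis
    by (simp add: ray_def climb)
qed

lemma translation_invariant_blocks: "translation_invariant m blocks"
proof (rule translation_invariantI)
  fix B
  have single: "(\<forall>y. \<not> arc (x + int m) y \<and> \<not> arc y (x + int m)) \<longleftrightarrow>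
      (\<forall>y. \<not> arc x y \<and> \<not> arc y x)" for x
    using arc_shift_left[of x] arc_shift_right[of x] by blast
  show "translate (int m) B \<in> blocks \<longleftrightarrow> B \<in> blocks"
  proof
    assume "B \<in> blocks"
    then consider a b where "B = {a, b}" "arc a b"
      | x where "B = {x}" "\<forall>y. \<not> arc x y \<and> \<not> arc y x"
      unfolding blocks_def by blast
    then show "translate (int m) B \<in> blocks"
    proof cases
      case 1
      then have "arc (a + int m) (b + int m)" by (simp add: arc_shift)
      then show ?thesis unfolding blocks_def 1(1) translate_insert translate_empty by blast
    next
      case 2
      then show ?thesis using single[of x] single_in_blocks by simp
    qed
  next
    assume "translate (int m) B \<in> blocks"
    then consider a b where "translate (int m) B = {a, b}" "arc a b"
      | x where "translate (int m) B = {x}" "\<forall>y. \<not> arc x y \<and> \<not> arc y x"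
      unfolding blocks_def by blast
    then show "B \<in> blocks"
    proof cases
      case 1
      have "B = translate (- int m) {a, b}" unfolding 1(1)[symmetric] by simp
      then have "B = {a - int m, b - int m}" by simp
      moreover have "arc (a - int m) (b - int m)"
        using arc_shift[of "a - int m" "b - int m"] 1 by simp
      ultimately show ?thesis unfolding blocks_def by blast
    next
      case 2
      have "B = translate (- int m) {x}" unfolding 2(1)[symmetric] by simp
      then have "B = {x - int m}" by simp
      then show ?thesis using single[of "x - int m"] 2 single_in_blocks by simp
    qed
  qed
qed

text \<open>
  This formula depends on \<open>x\<close> alone, so two blocks that share a point are equal.
\<close>

lemma block_containing:
  assumes "B \<in> blocks" "x \<in> B"
  shows "B = {z. z = x \<or> arc x z \<or> arc z x}"
proof -
  consider a b where "B = {a, b}" "arc a b" | "B = {x}" "\<forall>y. \<not> arc x y \<and> \<not> arc y x"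
    using assms unfolding blocks_def by blast
  then show ?thesis
  proof cases
    case 1
    then have "arc a z \<longleftrightarrow> z = b" "arc z b \<longleftrightarrow> z = a" "\<not> arc z a" "\<not> arc b z" for z
      using arc_functional arc_injective arc_not_chained by blast+
    then show ?thesis using 1(1) assms(2) by auto
  next
    case 2
    then show ?thesis by auto
  qed
qed

lemma planar_top_blocks: "planar_top m blocks rays"
proof
  show "partition_on UNIV blocks"
  proof (rule partition_onI)
    have "x \<in> \<Union> blocks" for x
    proof (cases "\<exists>y. arc x y \<or> arc y x")
      case True
      then obtain y where "{x, y} \<in> blocks"
        unfolding blocks_def by (blast intro: insert_commute)
      then show ?thesis by blast
    next
      case False
      then have "{x} \<in> blocks" by (simp add: single_in_blocks)
      then show ?thesis by blast
    qed
    then show "\<Union> blocks = UNIV" by blast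
    fix B B' assume B: "B \<in> blocks" "B' \<in> blocks" "B \<noteq> B'"
    have "B = B'" if "x \<in> B" "x \<in> B'" for x
      using block_containing[OF B(1) that(1)] block_containing[OF B(2) that(2)] by simp
    then show "disjnt B B'"
      using B by (auto simp: disjnt_def)
  qed (auto simp: blocks_def)
  show "finite B \<and> card B \<le> 2" if "B \<in> blocks" for B
    using that by (auto simp: blocks_def card_insert_if)
  show "translation_invariant m blocks" by (rule translation_invariant_blocks)
  show "rays \<subseteq> blocks"
  proof
    fix B assume "B \<in> rays"
    then obtain x where "B = {x}" "ray x" by (auto simp: rays_def)
    then show "B \<in> blocks"
      using arc_down[of _ x] single_in_blocks[of x] by (fastforce simp: ray_def)
  qed
  show "card B = 1" if "B \<in> rays" for B
    using that by (auto simp: rays_def)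
  have "rays = (\<lambda>x. {x}) ` {x. ray x}" by (auto simp: rays_def)
  then show "translation_invariant m rays"
    using translation_invariant_singletons[of m "{x. ray x}"] ray_shift by (simp add: periodic_def)
  show "planar blocks rays"
    unfolding planar_def
  proof (intro conjI allI impI notI)
    fix a b c d assume P: "{a, b} \<in> blocks" "{c, d} \<in> blocks" and "a < c \<and> c < b \<and> b < d"
    then have "arc a b" "arc c d" using pair_in_blocks by auto
    then have "h a < h c" "h (b + 1) = h a" "h c < h (b + 1)"
      using \<open>a < c \<and> c < b \<and> b < d\<close> arc_above[of a b c] arc_above[of c d "b + 1"]
      by (linarith, simp add: arc_def, linarith)
    then show False by simp
  next
    fix a b c assume P: "{a, b} \<in> blocks" "{c} \<in> rays" and o: "a < c \<and> c < b"
    then have "arc a b" "ray c" using pair_in_blocks single_in_rays by auto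
    then have "h (b + 1) \<le> h c" "h c < h (c + 1)"
      using o by (auto simp: arc_def ray_def)
    then obtain b' where "arc c b'" using up_opens[of c "b + 1"] o by auto
    then show False using \<open>ray c\<close> by (simp add: ray_def)
  qed
qed

end

text \<open>
  The sum of the steps from \<open>0\<close> to \<open>x\<close>; for negative \<open>x\<close> the path is followed backwards, which is
  what the second sum does.
\<close>

definition word_height :: "int set \<Rightarrow> int set \<Rightarrow> int \<Rightarrow> int" where
  "word_height C I x = (let w = \<lambda>y. if y \<in> C then -1 else if y \<in> I then 0 else 1
     in (\<Sum>y\<in>{0..<x}. w y) - (\<Sum>y\<in>{x..<0}. w y))"

lemma word_height_step:
  "word_height C I (x + 1) = word_height C I x + (if x \<in> C then -1 else if x \<in> I then 0 else 1)"
proof (cases "0 \<le> x")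
  case True
  then have "{0..<x + 1} = insert x {0..<x}" by auto
  then show ?thesis using True by (simp add: word_height_def Let_def)
next
  case False
  then have "{x..<0} = insert x {x + 1..<0}" by auto
  then show ?thesis using False by (simp add: word_height_def Let_def)
qed

text \<open>
  Translating by a period changes every height by the same amount, as the steps are periodic. The
  amount is the sum over one period of the steps \<open>1 - [y \<in> I] - 2 [y \<in> C]\<close>.
\<close>

lemma word_height_climb:
  assumes "periodic m C" "periodic m I" "C \<inter> I = {}"
    and "card (I \<inter> period m) + 2 * card (C \<inter> period m) + l = m"
  shows "word_height C I (x + int m) = word_height C I x + int l"
proof -
  let ?h = "word_height C I"
  have shift: "?h (x + int m + 1) - ?h (x + 1) = ?h (x + int m) - ?h x" for x
    using assms(1,2) word_height_step[of C I x] word_height_step[of C I "x + int m"]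
    by (simp add: periodic_def)
  have base: "?h (int m) = int l"
  proof -
    have "(if y \<in> C then -1 else if y \<in> I then 0 else 1) =
        (1::int) - of_bool (y \<in> I) - 2 * of_bool (y \<in> C)" for y
      using assms(3) by auto
    then have "?h (int m) = (\<Sum>y\<in>period m. 1 - of_bool (y \<in> I) - 2 * of_bool (y \<in> C))"
      by (simp add: word_height_def)
    also have "\<dots> = int m - int (card (I \<inter> period m)) - 2 * int (card (C \<inter> period m))"
      by (simp add: sum_subtractf sum.If_cases Int_commute flip: sum_distrib_left)
    finally show ?thesis using assms(4) by linarith
  qed
  have "?h (x + int m) - ?h x = ?h (int m)"
  proof (induction x rule: int_induct[where k = 0])
    case base
    then show ?case by (simp add: word_height_def)
  next
    case (step1 i)
    then show ?case using shift[of i] by (simp add: algebra_simps)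
  next
    case (step2 i)
    then show ?case using shift[of "i - 1"] by (simp add: algebra_simps)
  qed
  then show ?thesis using base by simp
qed

lemma planar_top_of_word:
  assumes "1 \<le> m" "periodic m C" "periodic m I" "C \<inter> I = {}"
    and "card (I \<inter> period m) + 2 * card (C \<inter> period m) + l = m"
  obtains P M where "planar_top m P M" "closers P = C" "isolated P M = I"
proof -
  interpret height_function m l "word_height C I"
    using assms word_height_climb[OF assms(2-5)]
    by unfold_locales (auto simp: word_height_step)
  have "closers blocks = C" "isolated blocks rays = I"
    using assms(4) by (auto simp: closers_blocks isolated_blocks word_height_step split: if_splits)
  then show thesis using that planar_top_blocks by blast
qed

section \<open>Counting\<close>

lemma top_set_Mo_iff:
  "(P, M) \<in> top_set Mo m l \<longleftrightarrow> planar_top m P M \<and> card (block_orbits m M) = l"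
proof -
  have "card B = 1 \<or> card B = 2" if "planar_top m P M" "B \<in> P" for B
  proof -
    interpret planar_top m P M by fact
    show ?thesis using that(2) by (cases rule: block_cases) simp_all
  qed
  then show ?thesis
    unfolding top_set_def planar_top_def by (simp only: mem_Collect_eq prod.case admissible.simps) blast
qed

text \<open>
  The Temperley-Lieb condition on unmarked blocks says precisely that a Motzkin top half has no
  isolated point.
\<close>

lemma top_set_TL_iff:
  "(P, M) \<in> top_set TL m l \<longleftrightarrow> (P, M) \<in> top_set Mo m l \<and> isolated P M = {}"
proof -
  have "(\<forall>B\<in>P - M. card B = 2) \<longleftrightarrow> (\<forall>B\<in>P - M. card B = 1 \<or> card B = 2) \<and> isolated P M = {}"
  proof -
    have "isolated P M = {} \<longleftrightarrow> (\<forall>B\<in>P - M. card B \<noteq> 1)"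
      by (auto simp: isolated_def card_1_singleton_iff)
    then show ?thesis by auto
  qed
  then show ?thesis
    unfolding top_set_def by auto
qed

definition period_word :: "nat \<Rightarrow> int set set \<times> int set set \<Rightarrow> int set \<times> int set" where
  "period_word m = (\<lambda>(P, M). (closers P \<inter> period m, isolated P M \<inter> period m))"

definition period_words :: "nat \<Rightarrow> nat \<Rightarrow> (int set \<times> int set) set" where
  "period_words m l = {(c, i). c \<subseteq> period m \<and> i \<subseteq> period m - c \<and> card i + 2 * card c + l = m}"

text \<open>
  For surjectivity it suffices to realise the word by any planar top half: \<open>period_count\<close> then
  forces the number of marked orbits to be \<open>l\<close>.
\<close>

lemma bij_betw_period_word:
  assumes m: "1 \<le> m"
  shows "bij_betw (period_word m) (top_set Mo m l) (period_words m l)"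
proof (rule bij_betw_imageI)
  show "inj_on (period_word m) (top_set Mo m l)"
  proof (rule inj_onI, clarify)
    fix P M P' M'
    assume "(P, M) \<in> top_set Mo m l" "(P', M') \<in> top_set Mo m l"
      and eq: "period_word m (P, M) = period_word m (P', M')"
    then have T: "planar_top m P M" and T': "planar_top m P' M'"
      by (simp_all add: top_set_Mo_iff)
    have c: "closers P = closers P'"
      using periodic_eqI[OF m planar_top.periodic_closers[OF T] planar_top.periodic_closers[OF T']]
        eq by (simp add: period_word_def)
    have i: "isolated P M = isolated P' M'"
      using periodic_eqI[OF m planar_top.periodic_isolated[OF T] planar_top.periodic_isolated[OF T']]
        eq by (simp add: period_word_def)
    show "P = P' \<and> M = M'"
      using block_transfer[OF T T' c i] block_transfer[OF T' T c[symmetric] i[symmetric]] by blast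
  qed
  have orbits: "card (block_orbits m M) = card (marked M \<inter> period m)" if "planar_top m P M" for P M
    using that card_block_orbits[OF m] unfolding planar_top_def by blast
  show "period_word m ` top_set Mo m l = period_words m l"
  proof (intro equalityI subsetI)
    fix w assume "w \<in> period_word m ` top_set Mo m l"
    then obtain P M where w: "w = period_word m (P, M)" and T: "planar_top m P M"
      and l: "card (block_orbits m M) = l"
      by (auto simp: top_set_Mo_iff)
    then show "w \<in> period_words m l"
      using planar_top.period_count[OF T m] orbits[OF T] planar_top.points_disjoint(4)[OF T]
      by (auto simp: period_word_def period_words_def)
  next
    fix w assume "w \<in> period_words m l"
    then obtain c i where w: "w = (c, i)" and sub: "c \<subseteq> period m" "i \<subseteq> period m"
      and disj: "c \<inter> i = {}" and count: "card i + 2 * card c + l = m"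
      by (auto simp: period_words_def)
    let ?C = "periodic_extension m c" and ?I = "periodic_extension m i"
    have ext: "?C \<inter> period m = c" "?I \<inter> period m = i"
      using sub by (simp_all only: periodic_extension_period)
    have "?C \<inter> ?I = {}" using disj by (auto simp: periodic_extension_def)
    then obtain P M where T: "planar_top m P M" and P: "closers P = ?C" "isolated P M = ?I"
      using planar_top_of_word[OF m periodic_periodic_extension periodic_periodic_extension]
        ext count by metis
    have "card (block_orbits m M) = l"
      using orbits[OF T] planar_top.period_count[OF T m] count by (simp only: P ext)
    then have "(P, M) \<in> top_set Mo m l" using T by (simp add: top_set_Mo_iff)
    moreover have "period_word m (P, M) = w" by (simp add: period_word_def P ext w)
    ultimately show "w \<in> period_word m ` top_set Mo m l" by blast
  qed
qed

lemma card_subsets_of_period: "card {c. c \<subseteq> period m \<and> card c = k} = m choose k"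
  using n_subsets[of "period m" k] by simp

lemma card_period_words:
  assumes "l \<le> m"
  shows "card (period_words m l) =
    (\<Sum>j=0..(m - l) div 2. (m choose j) * ((m - j) choose (m - l - 2 * j)))"
proof -
  define W where "W j = (SIGMA c:{c. c \<subseteq> period m \<and> card c = j}.
    {i. i \<subseteq> period m - c \<and> card i = m - l - 2 * j})" for j
  have "period_words m l = (\<Union>j\<in>{0..(m - l) div 2}. W j)"
    using assms by (auto simp: period_words_def W_def)
  moreover have "card (\<Union>j\<in>{0..(m - l) div 2}. W j) = (\<Sum>j=0..(m - l) div 2. card (W j))"
    by (rule card_UN_disjoint)
      (auto simp: W_def intro!: finite_SigmaI finite_subset[OF _ finite_Pow_iff[THEN iffD2]])
  moreover have "card (W j) = (m choose j) * ((m - j) choose (m - l - 2 * j))" for j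
  proof -
    have "card {i. i \<subseteq> period m - c \<and> card i = m - l - 2 * j} = (m - j) choose (m - l - 2 * j)"
      if "c \<subseteq> period m" "card c = j" for c
      using that n_subsets[of "period m - c" "m - l - 2 * j"]
      by (simp add: card_Diff_subset finite_subset[OF that(1)])
    then have "card (W j) = (\<Sum>c\<in>{c. c \<subseteq> period m \<and> card c = j}. (m - j) choose (m - l - 2 * j))"
      unfolding W_def by (subst card_SigmaI) (auto intro!: sum.cong)
    then show ?thesis by (simp add: card_subsets_of_period)
  qed
  ultimately show ?thesis by simp
qed

lemma card_top_set_Mo:
  assumes "1 \<le> m" "l \<le> m"
  shows "card (top_set Mo m l) =
    (\<Sum>j=0..(m - l) div 2. (m choose j) * ((m - j) choose (m - l - 2 * j)))"
  using bij_betw_same_card[OF bij_betw_period_word[OF assms(1)]] card_period_words[OF assms(2)]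
  by simp

lemma card_top_set_TL:
  assumes m: "1 \<le> m" and "l \<le> m" and parity: "m mod 2 = l mod 2"
  shows "card (top_set TL m l) = m choose ((m - l) div 2)"
proof -
  let ?K = "{c. c \<subseteq> period m \<and> card c = (m - l) div 2}"
  have TL: "top_set TL m l = {X \<in> top_set Mo m l. snd (period_word m X) = {}}"
  proof -
    have "isolated P M = {} \<longleftrightarrow> isolated P M \<inter> period m = {}" if "planar_top m P M" for P M
      using periodic_eqI[OF m planar_top.periodic_isolated[OF that], of "{}"]
      by (auto simp: periodic_def)
    then show ?thesis
      by (auto simp: top_set_TL_iff top_set_Mo_iff period_word_def)
  qed
  have word: "bij_betw (period_word m) (top_set TL m l) {w \<in> period_words m l. snd w = {}}"
  proof (rule bij_betw_subset[OF bij_betw_period_word[OF m, of l]])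
    show "top_set TL m l \<subseteq> top_set Mo m l" by (auto simp: TL)
    show "period_word m ` top_set TL m l = {w \<in> period_words m l. snd w = {}}"
      unfolding TL bij_betw_imp_surj_on[OF bij_betw_period_word[OF m, of l], symmetric] by auto
  qed
  have "{w \<in> period_words m l. snd w = {}} = (\<lambda>c. (c, {})) ` ?K"
  proof -
    have "2 * k + l = m \<longleftrightarrow> k = (m - l) div 2" for k
    proof -
      have "even (m - l)" using parity assms(2) by (metis mod_eq_dvd_iff_nat)
      then obtain d where "m - l = 2 * d" by (elim dvdE)
      then show ?thesis using assms(2) by auto
    qed
    then show ?thesis
      by (auto simp: period_words_def)
  qed
  moreover have "card ((\<lambda>c. (c, {} :: int set)) ` ?K) = card ?K"
    by (intro card_image inj_onI) simp
  ultimately show ?thesis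
    using bij_betw_same_card[OF word] by (simp only: card_subsets_of_period)
qed

text \<open>
  When all blocks are singletons, a top half is the same as its set of marked points, which can be
  any periodic set and so is given by its residues in one period.
\<close>

lemma card_top_set_rook:
  assumes m: "1 \<le> m" and rook: "\<And>P M. admissible T P M \<longleftrightarrow> (\<forall>B\<in>P. card B = 1)"
  shows "card (top_set T m l) = m choose l"
proof -
  let ?S = "range (\<lambda>x::int. {x})"
  let ?K = "{c. c \<subseteq> period m \<and> card c = l}"
  have S: "P = ?S" if P: "partition_on UNIV P" "\<forall>B\<in>P. card B = 1" for P :: "int set set"
  proof -
    have "marked P = UNIV"
    proof (intro equalityI subsetI UNIV_I)
      fix x :: int
      obtain B where "B \<in> P" "x \<in> B" using partition_onD1[OF P(1)] by blast
      moreover from this have "B = {x}"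
        using P(2) by (metis card_1_singletonE singletonD)
      ultimately show "x \<in> marked P" by (simp add: marked_def)
    qed
    then show ?thesis using singletons_marked[OF P(2)] by simp
  qed
  have iff: "(P, M) \<in> top_set T m l \<longleftrightarrow> P = ?S \<and> (\<forall>B\<in>M. card B = 1) \<and>
      translation_invariant m M \<and> card (marked M \<inter> period m) = l" for P M
  proof -
    have part: "partition_on UNIV ?S" by (auto simp: partition_on_def disjoint_def)
    have inv: "translation_invariant m ?S"
      by (rule translation_invariant_singletons) (simp add: periodic_def)
    have sub: "M \<subseteq> ?S" if "\<forall>B\<in>M. card B = 1"
      using that by (auto simp: card_1_singleton_iff)
    show ?thesis
    proof
      assume "(P, M) \<in> top_set T m l"
      then have "partition_on UNIV P" "\<forall>B\<in>P. card B = 1" "\<forall>B\<in>M. card B = 1"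
        "translation_invariant m M" "card (block_orbits m M) = l"
        unfolding top_set_def rook by simp_all
      then show "P = ?S \<and> (\<forall>B\<in>M. card B = 1) \<and>
          translation_invariant m M \<and> card (marked M \<inter> period m) = l"
        using S[of P] card_block_orbits[OF m, of M] by simp
    next
      assume "P = ?S \<and> (\<forall>B\<in>M. card B = 1) \<and>
          translation_invariant m M \<and> card (marked M \<inter> period m) = l"
      then have "P = ?S" "\<forall>B\<in>M. card B = 1" "translation_invariant m M"
        "card (block_orbits m M) = l"
        using card_block_orbits[OF m, of M] by simp_all
      moreover have "\<forall>B\<in>?S. card B = 1" "\<forall>B\<in>?S. finite B \<and> card B \<le> 2" by auto
      ultimately show "(P, M) \<in> top_set T m l"
        unfolding top_set_def rook using part inv sub by simp
    qed
  qed
  have "bij_betw (\<lambda>(P, M). marked M \<inter> period m) (top_set T m l) ?K"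
  proof (rule bij_betw_byWitness[where f' = "\<lambda>c. (?S, (\<lambda>x. {x}) ` periodic_extension m c)"])
    show "\<forall>X\<in>top_set T m l. (\<lambda>c. (?S, (\<lambda>x. {x}) ` periodic_extension m c))
        ((\<lambda>(P, M). marked M \<inter> period m) X) = X"
    proof clarify
      fix P M assume "(P, M) \<in> top_set T m l"
      then have M: "P = ?S" "\<forall>B\<in>M. card B = 1" "translation_invariant m M" by (auto simp: iff)
      have "periodic_extension m (marked M \<inter> period m) = marked M"
        by (rule periodic_eqI[OF m periodic_periodic_extension periodic_marked[OF M(3)]])
          (simp add: periodic_extension_period)
      then show "?S = P \<and> (\<lambda>x. {x}) ` periodic_extension m (marked M \<inter> period m) = M"
        using singletons_marked[OF M(2)] M(1) by simp
    qed
    show "\<forall>c\<in>?K. (\<lambda>(P, M). marked M \<inter> period m) (?S, (\<lambda>x. {x}) ` periodic_extension m c) = c"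
      by (simp add: marked_singletons periodic_extension_period)
    show "(\<lambda>(P, M). marked M \<inter> period m) ` top_set T m l \<subseteq> ?K"
      by (auto simp: iff)
    show "(\<lambda>c. (?S, (\<lambda>x. {x}) ` periodic_extension m c)) ` ?K \<subseteq> top_set T m l"
    proof (rule image_subsetI)
      fix c assume c: "c \<in> ?K"
      show "(?S, (\<lambda>x. {x}) ` periodic_extension m c) \<in> top_set T m l"
        unfolding iff using c translation_invariant_singletons[OF periodic_periodic_extension[of m c]]
        by (simp add: marked_singletons periodic_extension_period)
    qed
  qed
  from bij_betw_same_card[OF this] show ?thesis
    by (simp only: card_subsets_of_period)
qed

lemma trinomial_coefficient_factorials:
  assumes "2 * j \<le> m - l" "l \<le> m"
  shows "fact m / (fact j * fact (m - l - 2 * j) * fact (l + j)) =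
    real ((m choose j) * ((m - j) choose (m - l - 2 * j)))"
proof -
  have "m - j - (m - l - 2 * j) = l + j" using assms by simp
  then show ?thesis
    using assms by (simp add: binomial_fact add.commute)
qed

lemma coeff_one_plus_x_power: "coeff ([:1, 1:] ^ n :: nat poly) k = n choose k"
proof (induction n arbitrary: k)
  case 0
  then show ?case by (cases k) auto
next
  case (Suc n)
  then show ?case by (cases k) (simp_all add: mult_pCons_left coeff_pCons)
qed

text \<open>
  Grouping \<open>1 + t + t\<^sup>2\<close> as \<open>t\<^sup>2 + (1 + t)\<close> makes the index \<open>j\<close> of the binomial expansion the
  number of factors that contribute \<open>t\<^sup>2\<close>, that is, the number of closers.
\<close>

lemma coeff_trinomial_power:
  "coeff ([:1, 1, 1:] ^ m :: nat poly) k =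
    (\<Sum>j=0..k div 2. (m choose j) * ((m - j) choose (k - 2 * j)))"
proof -
  have split: "[:1, 1, 1:] = monom 1 2 + ([:1, 1:] :: nat poly)"
    by (simp add: monom_altdef numeral_2_eq_2)
  have summand: "coeff (of_nat (m choose j) * monom 1 2 ^ j * ([:1, 1:] :: nat poly) ^ (m - j)) k =
      (m choose j) * (if 2 * j \<le> k then (m - j) choose (k - 2 * j) else 0)" for j
  proof -
    have "of_nat (m choose j) * monom 1 2 ^ j = (monom (m choose j) (2 * j) :: nat poly)"
      by (simp add: monom_power of_nat_poly smult_monom)
    then show ?thesis
      by (simp only: coeff_monom_mult coeff_one_plus_x_power) simp
  qed
  have "coeff ([:1, 1, 1:] ^ m :: nat poly) k =
      (\<Sum>j\<le>m. (m choose j) * (if 2 * j \<le> k then (m - j) choose (k - 2 * j) else 0))"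
    unfolding split binomial_ring coeff_sum summand ..
  also have "\<dots> = (\<Sum>j=0..k div 2. (m choose j) * ((m - j) choose (k - 2 * j)))"
    by (rule sum.mono_neutral_cong) auto
  finally show ?thesis .
qed

theorem proposition3p4p2:
  fixes m l :: nat
  assumes "1 \<le> m" and "l \<le> m"
  shows
    "(m mod 2 = l mod 2 \<longrightarrow> card (top_set TL m l) = m choose ((m - l) div 2)) \<and>
     (real (card (top_set Mo m l)) =
        (\<Sum>j=0..(m - l) div 2. fact m / (fact j * fact (m - l - 2 * j) * fact (l + j))) \<and>
      (\<Sum>j=0..(m - l) div 2. fact m / (fact j * fact (m - l - 2 * j) * fact (l + j))) =
        real (\<Sum>j=0..(m - l) div 2. (m choose j) * ((m - j) choose (m - l - 2 * j))) \<and>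
      (\<Sum>j=0..(m - l) div 2. (m choose j) * ((m - j) choose (m - l - 2 * j))) =
        coeff ([:1, 1, 1:] ^ m) (m - l)) \<and>
     card (top_set PRo m l) = m choose l \<and>
     card (top_set Ro m l) = m choose l"
proof -
  have "(\<Sum>j=0..(m - l) div 2. fact m / (fact j * fact (m - l - 2 * j) * fact (l + j))) =
      real (\<Sum>j=0..(m - l) div 2. (m choose j) * ((m - j) choose (m - l - 2 * j)))"
    unfolding of_nat_sum
    by (intro sum.cong refl trinomial_coefficient_factorials) (use assms in auto)
  then show ?thesis
    using card_top_set_TL[OF assms] card_top_set_Mo[OF assms] coeff_trinomial_power[of m "m - l"]
      card_top_set_rook[OF assms(1), of PRo] card_top_set_rook[OF assms(1), of Ro]
    by simp
qed

end
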